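(* For all $\Gamma\cup\{A\}\subseteq \mathsf{Form}_\supset$: if $\Gamma\models A$, then $\Gamma\vdash A$ in the system $\mathbf{S}$.
   Context: Language: formulas $\mathsf{Form}_\supset$ are built from a countable set $\mathsf{Prop}$ of propositional variables using the binary connectives $\land,\lor,\to$ (intuitionistic implication) and $\supset$ (classical implication). Semantics: an $\mathbf{S}$-model is $\langle g,W,\leq,V\rangle$ where $W$ is a set, $g\in W$, $\leq$ is a reflexive and transitive relation on $W$ with $g\leq w$ for all $w\in W$, and $V:W\times\mathsf{Prop}\to\{0,1\}$ satisfies: if $V(w_1,p)=1$ and $w_1\leq w_2$ then $V(w_2,p)=1$. $V$ extends to $I$: $I(w,p)=V(w,p)$; $I(w,A\land B)=1$ iff $I(w,A)=1$ and $I(w,B)=1$; $I(w,A\lor B)=1$ iff $I(w,A)=1$ or $I(w,B)=1$; $I(w,A\supset B)=1$ iff $I(g,A)\neq 1$ or $I(w,B)=1$; $I(w,A\to B)=1$ iff for all $x\in W$ with $w\leq x$, $I(x,A)=1$ implies $I(x,B)=1$. $\Sigma\models A$ iff for every $\mathbf{S}$-model, if $I(g,B)=1$ for all $B\in\Sigma$ then $I(g,A)=1$. Proof system $\mathbf{S}$: axiom schemata (for all formulas $A,B,C$) (Ax1) $A\to(B\to A)$; (Ax2) $(A\to(B\to C))\to((A\to B)\to(A\to C))$; (Ax3) $(A\land B)\to A$; (Ax4) $(A\land B)\to B$; (Ax5) $(C\to A)\to((C\to B)\to(C\to(A\land B)))$; (Ax6) $A\to(A\lor B)$; (Ax7) $B\to(A\lor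 B)$; (Ax8) $(A\to C)\to((B\to C)\to((A\lor B)\to C))$; (AxM1) $(A\to B)\supset(A\supset B)$; (AxM2) $(A\supset(B\supset C))\to((A\supset B)\supset(A\supset C))$; (AxM3) $(A\supset(B\to C))\to(B\to(A\supset C))$; (AxM4) $(A\to(B\supset C))\to(B\supset(A\to C))$; (AxM5) $((A\supset B)\supset C)\to((A\supset C)\to C)$; (AxM6) $(A\supset C)\to((B\supset C)\to((A\lor B)\supset C))$; and the single rule (MP): from $A$ and $A\supset B$ infer $B$. $\Gamma\vdash A$ iff there is a finite sequence ending in $A$ each member of which is in $\Gamma$, an axiom instance, or obtained by (MP) from earlier members. *)

theory Defs
  imports Main "HOL-Library.Countable"
begin

datatype 'p form =
    Var 'p
  | Conj "'p form" "'p form"  (infixl "\<^bold>\<and>" 70)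
  | Disj "'p form" "'p form"  (infixl "\<^bold>\<or>" 68)
  | IImp "'p form" "'p form"  (infixr "\<^bold>\<longrightarrow>" 66)
  | CImp "'p form" "'p form"  (infixr "\<^bold>\<supset>" 66)

text \<open>
  \<open>IImp\<close> is intuitionistic implication, \<open>CImp\<close> is classical implication.

  In a model, \<open>W\<close> is a carrier set inside an arbitrary type of worlds; the values of
  \<open>le\<close> and \<open>V\<close> outside \<open>W\<close> play no role.
\<close>

locale S_model =
  fixes g :: 'w
    and W :: "'w set"
    and le :: "'w \<Rightarrow> 'w \<Rightarrow> bool"
    and V :: "'w \<Rightarrow> 'p \<Rightarrow> bool"
  assumes root_in: "g \<in> W"
    and refl: "reflp_on W le"
    and trans: "transp_on W le"
    and root_least: "\<And>w. w \<in> W \<Longrightarrow> le g w"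
    and persistent: "\<And>w1 w2 p. w1 \<in> W \<Longrightarrow> w2 \<in> W \<Longrightarrow> V w1 p \<Longrightarrow> le w1 w2 \<Longrightarrow> V w2 p"

primrec interp ::
  "'w \<Rightarrow> 'w set \<Rightarrow> ('w \<Rightarrow> 'w \<Rightarrow> bool) \<Rightarrow> ('w \<Rightarrow> 'p \<Rightarrow> bool) \<Rightarrow> 'w \<Rightarrow> 'p form \<Rightarrow> bool"
where
  "interp g W le V w (Var p) \<longleftrightarrow> V w p"
| "interp g W le V w (A \<^bold>\<and> B) \<longleftrightarrow> interp g W le V w A \<and> interp g W le V w B"
| "interp g W le V w (A \<^bold>\<or> B) \<longleftrightarrow> interp g W le V w A \<or> interp g W le V w B"
| "interp g W le V w (A \<^bold>\<longrightarrow> B) \<longleftrightarrow>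
     (\<forall>x\<in>W. le w x \<longrightarrow> interp g W le V x A \<longrightarrow> interp g W le V x B)"
| "interp g W le V w (A \<^bold>\<supset> B) \<longleftrightarrow> \<not> interp g W le V g A \<or> interp g W le V w B"

text \<open>
  HOL cannot quantify over all types inside a formula, so consequence is relative to the type
  \<open>'w\<close> from which the carriers \<open>W\<close> are drawn. Restricting the worlds to one type only
  weakens consequence as a hypothesis, hence only strengthens a completeness theorem.
\<close>

definition entails :: "'w itself \<Rightarrow> 'p form set \<Rightarrow> 'p form \<Rightarrow> bool" where
  "entails (_ :: 'w itself) \<Sigma> A \<longleftrightarrow>
     (\<forall>(g :: 'w) W le V. S_model g W le V \<longrightarrow>
        (\<forall>B\<in>\<Sigma>. interp g W le V g B) \<longrightarrow> interp g W le V g A)"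

inductive S_axiom :: "'p form \<Rightarrow> bool" where
  Ax1: "S_axiom (A \<^bold>\<longrightarrow> (B \<^bold>\<longrightarrow> A))"
| Ax2: "S_axiom ((A \<^bold>\<longrightarrow> (B \<^bold>\<longrightarrow> C)) \<^bold>\<longrightarrow> ((A \<^bold>\<longrightarrow> B) \<^bold>\<longrightarrow> (A \<^bold>\<longrightarrow> C)))"
| Ax3: "S_axiom ((A \<^bold>\<and> B) \<^bold>\<longrightarrow> A)"
| Ax4: "S_axiom ((A \<^bold>\<and> B) \<^bold>\<longrightarrow> B)"
| Ax5: "S_axiom ((C \<^bold>\<longrightarrow> A) \<^bold>\<longrightarrow> ((C \<^bold>\<longrightarrow> B) \<^bold>\<longrightarrow> (C \<^bold>\<longrightarrow> (A \<^bold>\<and> B))))"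
| Ax6: "S_axiom (A \<^bold>\<longrightarrow> (A \<^bold>\<or> B))"
| Ax7: "S_axiom (B \<^bold>\<longrightarrow> (A \<^bold>\<or> B))"
| Ax8: "S_axiom ((A \<^bold>\<longrightarrow> C) \<^bold>\<longrightarrow> ((B \<^bold>\<longrightarrow> C) \<^bold>\<longrightarrow> ((A \<^bold>\<or> B) \<^bold>\<longrightarrow> C)))"
| AxM1: "S_axiom ((A \<^bold>\<longrightarrow> B) \<^bold>\<supset> (A \<^bold>\<supset> B))"
| AxM2: "S_axiom ((A \<^bold>\<supset> (B \<^bold>\<supset> C)) \<^bold>\<longrightarrow> ((A \<^bold>\<supset> B) \<^bold>\<longrightarrow> (A \<^bold>\<supset> C)))"
| AxM3: "S_axiom ((A \<^bold>\<supset> (B \<^bold>\<longrightarrow> C)) \<^bold>\<longrightarrow> (B \<^bold>\<longrightarrow> (A \<^bold>\<supset> C)))"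
| AxM4: "S_axiom ((A \<^bold>\<longrightarrow> (B \<^bold>\<supset> C)) \<^bold>\<longrightarrow> (B \<^bold>\<supset> (A \<^bold>\<longrightarrow> C)))"
| AxM5: "S_axiom (((A \<^bold>\<supset> B) \<^bold>\<supset> C) \<^bold>\<longrightarrow> ((A \<^bold>\<supset> C) \<^bold>\<longrightarrow> C))"
| AxM6: "S_axiom ((A \<^bold>\<supset> C) \<^bold>\<longrightarrow> ((B \<^bold>\<supset> C) \<^bold>\<longrightarrow> ((A \<^bold>\<or> B) \<^bold>\<supset> C)))"

definition is_derivation :: "'p form set \<Rightarrow> 'p form list \<Rightarrow> bool" where
  "is_derivation \<Gamma> ds \<longleftrightarrow>
     (\<forall>i<length ds. ds ! i \<in> \<Gamma> \<or> S_axiom (ds ! i) \<or>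
        (\<exists>j<i. \<exists>k<i. ds ! k = (ds ! j \<^bold>\<supset> ds ! i)))"

definition derives :: "'p form set \<Rightarrow> 'p form \<Rightarrow> bool"  (infix "\<turnstile>\<^sub>S" 50) where
  "\<Gamma> \<turnstile>\<^sub>S A \<longleftrightarrow> (\<exists>ds. ds \<noteq> [] \<and> is_derivation \<Gamma> ds \<and> last ds = A)"

end

(*
  A maximal \<supset>-closed extension G of \<Gamma> avoiding A is prime and treats \<supset> classically
  (AxM5, AxM6). It is the root of the canonical model, whose worlds are the prime
  extensions of G that are closed under detachment for \<longrightarrow> only; AxM4 is what makes
  B \<supset> C at such a world depend on whether B belongs to G.
*)
theory Submission
  imports Defs
begin

section \<open>Maximal sets closed under detachment, for an arbitrary implication\<close>

definition detaches :: "('a \<Rightarrow> 'a \<Rightarrow> 'a) \<Rightarrow> 'a set \<Rightarrow> bool" where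
  "detaches f T \<longleftrightarrow> (\<forall>A B. f A B \<in> T \<longrightarrow> A \<in> T \<longrightarrow> B \<in> T)"

lemma detachesD: "detaches f T \<Longrightarrow> f A B \<in> T \<Longrightarrow> A \<in> T \<Longrightarrow> B \<in> T"
  unfolding detaches_def by blast

text \<open>This is the combinator identity I = S K K.\<close>

lemma detaches_refl:
  assumes "detaches f T"
    and "\<And>A B. f A (f B A) \<in> T"
    and "\<And>A B C. f (f A (f B C)) (f (f A B) (f A C)) \<in> T"
  shows "f A A \<in> T"
  using detachesD[OF assms(1)] assms(2,3) by meson

text \<open>A Lindenbaum lemma for any connective \<open>f\<close> with the K and S schemes, so that
  one argument serves \<open>CImp\<close>, for the root, and \<open>IImp\<close>, for the other
  worlds. The last conclusion holds because otherwise adding \<open>B\<close> would give a larger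
  closed set still avoiding \<open>C\<close>.\<close>

lemma exists_maximal_detaching:
  assumes T0: "detaches f T0" and C: "C \<notin> T0"
    and K: "\<And>A B. f A (f B A) \<in> T0"
    and S: "\<And>A B C. f (f A (f B C)) (f (f A B) (f A C)) \<in> T0"
  obtains T where "T0 \<subseteq> T" "detaches f T" "C \<notin> T" "\<And>B. B \<notin> T \<Longrightarrow> f B C \<in> T"
proof -
  let ?F = "{T. T0 \<subseteq> T \<and> detaches f T \<and> C \<notin> T}"
  have "\<exists>M\<in>?F. \<forall>X\<in>?F. M \<subseteq> X \<longrightarrow> X = M"
  proof (rule subset_Zorn_nonempty)
    show "?F \<noteq> {}" using T0 C by blast
  next
    fix \<C> assume ne: "\<C> \<noteq> {}" and ch: "subset.chain ?F \<C>"
    have "detaches f (\<Union>\<C>)"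
      unfolding detaches_def
    proof (intro allI impI)
      fix A B assume "f A B \<in> \<Union>\<C>" "A \<in> \<Union>\<C>"
      then obtain X Y where XY: "X \<in> \<C>" "Y \<in> \<C>" "f A B \<in> X" "A \<in> Y" by blast
      with ch have "X \<subseteq> Y \<or> Y \<subseteq> X" "detaches f X" "detaches f Y"
        unfolding subset.chain_def by blast+
      with XY show "B \<in> \<Union>\<C>" by (meson UnionI detachesD subsetD)
    qed
    with ne ch show "\<Union>\<C> \<in> ?F" unfolding subset.chain_def by blast
  qed
  then obtain M where M: "T0 \<subseteq> M" "detaches f M" "C \<notin> M"
    and max: "\<And>X. T0 \<subseteq> X \<Longrightarrow> detaches f X \<Longrightarrow> C \<notin> X \<Longrightarrow> M \<subseteq> X \<Longrightarrow> X = M"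
    by auto
  note mp = detachesD[OF M(2)]
  have KM: "f A (f B A) \<in> M" and SM: "f (f A (f B C)) (f (f A B) (f A C)) \<in> M" for A B C
    using K S M(1) by blast+
  have "f B C \<in> M" if B: "B \<notin> M" for B
  proof (rule ccontr)
    assume "f B C \<notin> M"
    \<comment> \<open>By \<open>S\<close>, the set of all \<open>D\<close> with \<open>f B D \<in> M\<close> is itself closed under detachment.\<close>
    let ?X = "{D. f B D \<in> M}"
    have "detaches f ?X" unfolding detaches_def using mp SM by blast
    moreover have sub: "M \<subseteq> ?X" using mp KM by blast
    ultimately have "?X = M" using max M(1) \<open>f B C \<notin> M\<close> by blast
    moreover have "B \<in> ?X" using detaches_refl[of f M, OF M(2) KM SM] by simp
    ultimately show False using B by simp
  qed
  with M that show thesis by blast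
qed

section \<open>Derivability and modus ponens\<close>

lemma is_derivation_append:
  assumes "is_derivation \<Gamma> xs" "is_derivation \<Gamma> ys"
  shows "is_derivation \<Gamma> (xs @ ys)"
  unfolding is_derivation_def
proof (intro allI impI)
  fix i assume i: "i < length (xs @ ys)"
  let ?zs = "xs @ ys" and ?n = "length xs"
  show "?zs ! i \<in> \<Gamma> \<or> S_axiom (?zs ! i) \<or> (\<exists>j<i. \<exists>k<i. ?zs ! k = (?zs ! j \<^bold>\<supset> ?zs ! i))"
  proof (cases "i < ?n")
    case True
    with assms(1) consider "xs ! i \<in> \<Gamma> \<or> S_axiom (xs ! i)"
      | j k where "j < i" "k < i" "xs ! k = (xs ! j \<^bold>\<supset> xs ! i)"
      unfolding is_derivation_def by blast
    then show ?thesis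
    proof cases
      case 1
      moreover have "?zs ! i = xs ! i" using True by (simp add: nth_append)
      ultimately show ?thesis by metis
    next
      case (2 j k)
      with True have "?zs ! k = (?zs ! j \<^bold>\<supset> ?zs ! i)" by (simp add: nth_append)
      with 2 show ?thesis by blast
    qed
  next
    case False
    define m where "m = i - ?n"
    have im: "i = ?n + m" "m < length ys" using False i m_def by auto
    with assms(2) consider "ys ! m \<in> \<Gamma> \<or> S_axiom (ys ! m)"
      | j k where "j < m" "k < m" "ys ! k = (ys ! j \<^bold>\<supset> ys ! m)"
      unfolding is_derivation_def by blast
    then show ?thesis
    proof cases
      case 1
      moreover have "?zs ! i = ys ! m" using im by simp
      ultimately show ?thesis by metis
    next
      case (2 j k)
      with im have "?zs ! (?n + k) = (?zs ! (?n + j) \<^bold>\<supset> ?zs ! i)" "?n + j < i" "?n + k < i"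
        by simp_all
      then show ?thesis by blast
    qed
  qed
qed

lemma derives_base: "B \<in> \<Gamma> \<or> S_axiom B \<Longrightarrow> \<Gamma> \<turnstile>\<^sub>S B"
  unfolding derives_def is_derivation_def by (rule exI[of _ "[B]"]) simp

lemma derives_MP:
  assumes "\<Gamma> \<turnstile>\<^sub>S A \<^bold>\<supset> B" "\<Gamma> \<turnstile>\<^sub>S A"
  shows "\<Gamma> \<turnstile>\<^sub>S B"
proof -
  obtain xs ys where xs: "xs \<noteq> []" "is_derivation \<Gamma> xs" "last xs = (A \<^bold>\<supset> B)"
    and ys: "ys \<noteq> []" "is_derivation \<Gamma> ys" "last ys = A"
    using assms unfolding derives_def by blast
  let ?zs = "xs @ ys"
  \<comment> \<open>Each premise ends its block: \<open>?j\<close> locates \<open>A\<close> at the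
    end of \<open>ys\<close>, \<open>?k\<close> the implication at the end of
    \<open>xs\<close>.\<close>
  let ?j = "length ?zs - 1" and ?k = "length xs - 1"
  have D: "is_derivation \<Gamma> ?zs" using is_derivation_append xs(2) ys(2) .
  have zj: "?zs ! ?j = A"
    using last_conv_nth[of ?zs] ys(1,3) by simp
  have zk: "?zs ! ?k = (A \<^bold>\<supset> B)"
    using last_conv_nth[of xs] xs by (simp add: nth_append)
  have "is_derivation \<Gamma> (?zs @ [B])"
    unfolding is_derivation_def
  proof (intro allI impI)
    fix i assume i: "i < length (?zs @ [B])"
    let ?us = "?zs @ [B]"
    show "?us ! i \<in> \<Gamma> \<or> S_axiom (?us ! i) \<or> (\<exists>j<i. \<exists>k<i. ?us ! k = (?us ! j \<^bold>\<supset> ?us ! i))"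
    proof (cases "i < length ?zs")
      case True
      with D consider "?zs ! i \<in> \<Gamma> \<or> S_axiom (?zs ! i)"
        | j k where "j < i" "k < i" "?zs ! k = (?zs ! j \<^bold>\<supset> ?zs ! i)"
        unfolding is_derivation_def by blast
      then show ?thesis
      proof cases
        case 1
        moreover have "?us ! i = ?zs ! i" using True by (simp only: nth_append if_True)
        ultimately show ?thesis by metis
      next
        case (2 j k)
        with True have "?us ! k = (?us ! j \<^bold>\<supset> ?us ! i)"
          by (simp only: nth_append[of ?zs] if_True less_trans[OF _ True])
        with 2 show ?thesis by blast
      qed
    next
      case False
      with i have ieq: "i = length ?zs" by simp
      have jk: "?j < length ?zs" "?k < length ?zs" using xs(1) by (cases xs; simp)+
      have "?us ! ?k = (?us ! ?j \<^bold>\<supset> ?us ! i)"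
        unfolding ieq nth_append_length nth_append[of ?zs "[B]" ?k] nth_append[of ?zs "[B]" ?j]
        using jk zj zk by (simp only: if_True)
      then show ?thesis using jk unfolding ieq by blast
    qed
  qed
  then show ?thesis unfolding derives_def by (intro exI[of _ "?zs @ [B]"]) simp
qed

section \<open>Consequences of the axioms inside a set closed under \<open>CImp\<close>\<close>

context
  fixes T :: "'p form set"
  assumes ax: "\<And>B. S_axiom B \<Longrightarrow> B \<in> T" and mp: "detaches CImp T"
begin

text \<open>\<open>AxM1\<close> turns an intuitionistic implication into a classical one, which can
  then be detached.\<close>

lemma detaches_IImp: "detaches IImp T"
  unfolding detaches_def using detachesD[OF mp] ax[OF AxM1] by blast

lemma IImp_refl: "A \<^bold>\<longrightarrow> A \<in> T"
  using detaches_refl[of IImp T A, OF detaches_IImp] ax Ax1 Ax2 by blast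

text \<open>\<open>AxM3\<close> exchanges the two antecedents of
  \<open>CImp B (IImp A A)\<close>.\<close>

lemma IImp_CImp_weaken: "A \<^bold>\<longrightarrow> (B \<^bold>\<supset> A) \<in> T"
proof -
  have "B \<^bold>\<longrightarrow> (A \<^bold>\<longrightarrow> A) \<in> T"
    using detachesD[OF detaches_IImp] ax[OF Ax1] IImp_refl by blast
  then have "B \<^bold>\<supset> (A \<^bold>\<longrightarrow> A) \<in> T" using detachesD[OF mp] ax[OF AxM1] by blast
  then show ?thesis using detachesD[OF detaches_IImp] ax[OF AxM3] by blast
qed

lemma CImp_K: "A \<^bold>\<supset> (B \<^bold>\<supset> A) \<in> T"
  using IImp_CImp_weaken detachesD[OF mp] ax[OF AxM1] by blast

text \<open>\<open>AxM2\<close> has \<open>IImp\<close> where \<open>CImp\<close> is wanted. The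
  outer one is converted by \<open>AxM1\<close> directly; the inner one lies under the hypothesis
  \<open>?X\<close>, so an instance of \<open>AxM1\<close> is weakened by \<open>?X\<close> and
  distributed by \<open>AxM2\<close>.\<close>

lemma CImp_S: "(A \<^bold>\<supset> (B \<^bold>\<supset> C)) \<^bold>\<supset> ((A \<^bold>\<supset> B) \<^bold>\<supset> (A \<^bold>\<supset> C)) \<in> T"
proof -
  let ?X = "A \<^bold>\<supset> (B \<^bold>\<supset> C)" and ?Y = "A \<^bold>\<supset> B" and ?Z = "A \<^bold>\<supset> C"
  note MP = detachesD[OF mp] and MPi = detachesD[OF detaches_IImp]
  have 1: "?X \<^bold>\<supset> (?Y \<^bold>\<longrightarrow> ?Z) \<in> T" using MP ax[OF AxM1] ax[OF AxM2] by blast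
  have 2: "?X \<^bold>\<supset> ((?Y \<^bold>\<longrightarrow> ?Z) \<^bold>\<supset> (?Y \<^bold>\<supset> ?Z)) \<in> T" using MP CImp_K ax[OF AxM1] by blast
  have "(?X \<^bold>\<supset> (?Y \<^bold>\<longrightarrow> ?Z)) \<^bold>\<longrightarrow> (?X \<^bold>\<supset> (?Y \<^bold>\<supset> ?Z)) \<in> T" using MPi ax[OF AxM2] 2 by blast
  with 1 show ?thesis using MPi by blast
qed

text \<open>\<open>AxM4\<close> applied to the identity on \<open>CImp B C\<close>. It lets a world
  that detaches only \<open>IImp\<close> still detach \<open>CImp B C\<close> when \<open>B\<close>
  is in the root.\<close>

lemma CImp_detachment: "B \<^bold>\<supset> ((B \<^bold>\<supset> C) \<^bold>\<longrightarrow> C) \<in> T"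
  using detachesD[OF detaches_IImp] ax[OF AxM4] IImp_refl by blast

end

section \<open>The canonical model and completeness\<close>

theorem mainTheorem2:
  fixes \<Gamma> :: "'p::countable form set" and A :: "'p form"
  assumes "entails TYPE('p form set) \<Gamma> A"
  shows "\<Gamma> \<turnstile>\<^sub>S A"
proof (rule ccontr)
  assume A: "\<not> \<Gamma> \<turnstile>\<^sub>S A"
  \<comment> \<open>The preceding lemmas are used for two sets: for \<open>?T0\<close>, to supply K
    and S for the maximal extension, and then for \<open>G\<close> itself.\<close>
  let ?T0 = "{B. \<Gamma> \<turnstile>\<^sub>S B}"
  have T0: "detaches CImp ?T0" unfolding detaches_def using derives_MP by blast
  have T0_ax: "S_axiom B \<Longrightarrow> B \<in> ?T0" for B using derives_base by blast
  obtain G where G: "?T0 \<subseteq> G" "detaches CImp G" "A \<notin> G"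
    and max: "\<And>B. B \<notin> G \<Longrightarrow> B \<^bold>\<supset> A \<in> G"
  proof (rule exists_maximal_detaching[of CImp ?T0 A])
    show "A \<notin> ?T0" using A by simp
  qed (rule T0 CImp_K[OF T0_ax T0] CImp_S[OF T0_ax T0] that; assumption)+
  have ax: "S_axiom B \<Longrightarrow> B \<in> G" for B using G(1) T0_ax by blast
  note MP = detachesD[OF G(2)]
  have Gi: "detaches IImp G" by (rule detaches_IImp[OF ax G(2)])
  note MPi = detachesD[OF Gi]
  \<comment> \<open>If neither disjunct were in \<open>G\<close>, both would classically imply
    \<open>A\<close>, and \<open>AxM6\<close> would put \<open>A\<close> into
    \<open>G\<close>.\<close>
  have G_prime: "B \<in> G \<or> C \<in> G" if "B \<^bold>\<or> C \<in> G" for B C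
  proof (rule ccontr)
    assume "\<not> (B \<in> G \<or> C \<in> G)"
    then have "B \<^bold>\<supset> A \<in> G" "C \<^bold>\<supset> A \<in> G" using max by blast+
    with G(3) show False using MP[OF MPi[OF MPi[OF ax[OF AxM6]]] that] by blast
  qed
  \<comment> \<open>\<open>AxM5\<close> acts as excluded middle between \<open>B\<close> and
    \<open>CImp B C\<close>: if both were missing, both would imply \<open>A\<close>.\<close>
  have G_CImp: "B \<^bold>\<supset> C \<in> G" if "B \<notin> G" for B C
  proof (rule ccontr)
    assume "B \<^bold>\<supset> C \<notin> G"
    then have "(B \<^bold>\<supset> C) \<^bold>\<supset> A \<in> G" "B \<^bold>\<supset> A \<in> G" using max that by blast+
    with G(3) show False using MPi[OF MPi[OF ax[OF AxM5]]] by blast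
  qed

  \<comment> \<open>Closure under \<open>CImp\<close> cannot be demanded here: for \<open>B\<close>
    \<notin> \<open>G\<close> every \<open>CImp B C\<close> lies in \<open>G\<close>, while a larger
    world may contain \<open>B\<close> without \<open>C\<close>. Worlds are sets of formulas, which
    is the type at which \<open>entails\<close> is assumed.\<close>
  define W where "W = {T. G \<subseteq> T \<and> detaches IImp T \<and> (\<forall>B C. B \<^bold>\<or> C \<in> T \<longrightarrow> B \<in> T \<or> C \<in> T)}"
  define V where "V T p \<longleftrightarrow> Var p \<in> T" for T :: "'p form set" and p
  have GW: "G \<in> W" unfolding W_def using Gi G_prime by blast
  have model: "S_model G W (\<subseteq>) V"
    by unfold_locales (use GW in \<open>auto simp: reflp_on_def transp_on_def W_def V_def\<close>)

  have IImp_extension: "\<exists>T'\<in>W. T \<subseteq> T' \<and> B \<in> T' \<and> C \<notin> T'"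
    if T: "T \<in> W" and nin: "B \<^bold>\<longrightarrow> C \<notin> T" for T B C
  proof -
    have sub: "G \<subseteq> T" and d: "detaches IImp T" using T unfolding W_def by auto
    note MPT = detachesD[OF d]
    have axT: "S_axiom D \<Longrightarrow> D \<in> T" for D using ax sub by blast
    \<comment> \<open>By the deduction theorem, \<open>?U\<close> is the \<open>IImp\<close>-theory
      generated by \<open>T\<close> and \<open>B\<close>; it avoids \<open>C\<close> by
      \<open>nin\<close>.\<close>
    let ?U = "{D. B \<^bold>\<longrightarrow> D \<in> T}"
    have U: "detaches IImp ?U"
      unfolding detaches_def using MPT axT[OF Ax2] by blast
    have TU: "T \<subseteq> ?U" using MPT axT[OF Ax1] by blast
    have BU: "B \<in> ?U" using IImp_refl[OF ax G(2)] sub by blast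
    obtain T' where T': "?U \<subseteq> T'" "detaches IImp T'" "C \<notin> T'"
      and max': "\<And>D. D \<notin> T' \<Longrightarrow> D \<^bold>\<longrightarrow> C \<in> T'"
    proof (rule exists_maximal_detaching[of IImp ?U C])
      show "C \<notin> ?U" using nin by simp
    qed (rule U subsetD[OF TU axT[OF Ax1]] subsetD[OF TU axT[OF Ax2]] that; assumption)+
    have ax': "S_axiom D \<Longrightarrow> D \<in> T'" for D using axT TU T'(1) by blast
    \<comment> \<open>Primeness as for \<open>G\<close>, with \<open>Ax8\<close> in the place of
      \<open>AxM6\<close>.\<close>
    have "D \<in> T' \<or> E \<in> T'" if "D \<^bold>\<or> E \<in> T'" for D E
    proof (rule ccontr)
      assume "\<not> (D \<in> T' \<or> E \<in> T')"
      then have "D \<^bold>\<longrightarrow> C \<in> T'" "E \<^bold>\<longrightarrow> C \<in> T'" using max' by blast+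
      moreover note MP' = detachesD[OF T'(2)]
      ultimately show False
        using MP'[OF MP'[OF MP'[OF ax'[OF Ax8]]] that] T'(3) by blast
    qed
    then have "T' \<in> W" unfolding W_def using T' TU sub by blast
    then show ?thesis using T' TU BU by blast
  qed

  \<comment> \<open>The world stays arbitrary in the induction because \<open>IImp\<close> looks at
    larger worlds and \<open>CImp\<close> evaluates its antecedent at \<open>G\<close>.\<close>
  have truth: "interp G W (\<subseteq>) V T B \<longleftrightarrow> B \<in> T" if "T \<in> W" for T B
    using that
  proof (induction B arbitrary: T)
    case (Var p)
    then show ?case by (simp add: V_def)
  next
    case (Conj B C)
    have sub: "G \<subseteq> T" and d: "detaches IImp T" using Conj.prems unfolding W_def by auto
    note MPT = detachesD[OF d]
    have axT: "S_axiom D \<Longrightarrow> D \<in> T" for D using ax sub by blast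
    \<comment> \<open>\<open>Ax5\<close> builds a conjunction under a common antecedent; taking
      \<open>B\<close> as that antecedent leaves only \<open>IImp B B\<close> and
      \<open>IImp B C\<close> to supply.\<close>
    have reflT: "B \<^bold>\<longrightarrow> B \<in> T" using IImp_refl[OF ax G(2)] sub by blast
    have "B \<^bold>\<and> C \<in> T \<longleftrightarrow> B \<in> T \<and> C \<in> T"
    proof
      show "B \<^bold>\<and> C \<in> T \<Longrightarrow> B \<in> T \<and> C \<in> T"
        using MPT axT[OF Ax3] axT[OF Ax4] by blast
      assume BC: "B \<in> T \<and> C \<in> T"
      then have "B \<^bold>\<longrightarrow> C \<in> T" using MPT axT[OF Ax1] by blast
      then show "B \<^bold>\<and> C \<in> T" using MPT[OF MPT[OF MPT[OF axT[OF Ax5] reflT]]] BC by blast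
    qed
    then show ?case using Conj by simp
  next
    case (Disj B C)
    have sub: "G \<subseteq> T" and d: "detaches IImp T"
      and prime: "B \<^bold>\<or> C \<in> T \<Longrightarrow> B \<in> T \<or> C \<in> T"
      using Disj.prems unfolding W_def by auto
    have "B \<^bold>\<or> C \<in> T \<longleftrightarrow> B \<in> T \<or> C \<in> T"
      using prime detachesD[OF d, OF subsetD[OF sub ax[OF Ax6]]]
        detachesD[OF d, OF subsetD[OF sub ax[OF Ax7]]] by blast
    then show ?case using Disj by simp
  next
    case (IImp B C)
    have "B \<^bold>\<longrightarrow> C \<in> T \<longleftrightarrow> (\<forall>X\<in>W. T \<subseteq> X \<longrightarrow> B \<in> X \<longrightarrow> C \<in> X)"
    proof
      show "B \<^bold>\<longrightarrow> C \<in> T \<Longrightarrow> \<forall>X\<in>W. T \<subseteq> X \<longrightarrow> B \<in> X \<longrightarrow> C \<in> X"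
        unfolding W_def using detachesD[of IImp _ B C] by blast
    qed (use IImp_extension[OF IImp.prems] in blast)
    then show ?case using IImp by simp
  next
    case (CImp B C)
    have sub: "G \<subseteq> T" and d: "detaches IImp T" using CImp.prems unfolding W_def by auto
    have "B \<^bold>\<supset> C \<in> T \<longleftrightarrow> B \<notin> G \<or> C \<in> T"
    proof
      assume BC: "B \<^bold>\<supset> C \<in> T"
      have "C \<in> T" if "B \<in> G"
      proof -
        have "(B \<^bold>\<supset> C) \<^bold>\<longrightarrow> C \<in> G" using MP CImp_detachment[OF ax G(2)] that by blast
        then show ?thesis using detachesD[OF d] sub BC by blast
      qed
      then show "B \<notin> G \<or> C \<in> T" by blast
    next
      assume "B \<notin> G \<or> C \<in> T"
      then show "B \<^bold>\<supset> C \<in> T"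
        using G_CImp sub detachesD[OF d] IImp_CImp_weaken[OF ax G(2)] by blast
    qed
    then show ?case using CImp GW by simp
  qed

  \<comment> \<open>All of \<Gamma> is true at the root, so the assumed entailment makes
    \<open>A\<close> true there, against \<open>A\<close> \<notin> \<open>G\<close>.\<close>
  have "\<Gamma> \<subseteq> G" using G(1) derives_base by blast
  then have "interp G W (\<subseteq>) V G A"
    using assms model truth[OF GW] unfolding entails_def by blast
  then show False using truth[OF GW] G(3) by blast
qed

end
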